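(* Let $X$ be a quandle, $k$ a field, and $\phi$ a quandle $2$-cocycle of $X$ with coefficient group $A=k$. Let $W=k\oplus kX$ with its coalgebra structure and map $q:W\otimes W\to W$ described in the context. Define a linear map $\hat\phi:W\otimes W\to W$ by linearly extending $\hat\phi(x\otimes y)=\phi(x,y)\in k\subset W$, $\hat\phi(1\otimes x)=1$, and $\hat\phi(x\otimes 1)=\hat\phi(1\otimes 1)=0$ for $x,y\in X$. Then $\hat\phi$ satisfies $d^{2,1}(\hat\phi,0)=0$.
   Context: A quandle is a set $X$ with a binary operation $\triangleleft$ such that $a\triangleleft a=a$; for all $a,b$ there is a unique $c$ with $a=c\triangleleft b$; and $(a\triangleleft b)\triangleleft c=(a\triangleleft c)\triangleleft(b\triangleleft c)$. A quandle $2$-cocycle with coefficients in $k$ is a function $\phi:X\times X\to k$ with $\phi(x,y)-\phi(x,z)+\phi(x\triangleleft y,z)-\phi(x\triangleleft z,y\triangleleft z)=0$ for all $x,y,z$ and $\phi(x,x)=0$ for all $x$. $W=k\oplus kX$ ($kX$ the vector space with basis $X$) is the coalgebra with $\Delta(1)=1\otimes 1$, $\Delta(x)=x\otimes x$, $\epsilon(1)=1$, $\epsilon(x)=1$ ($1\in k$, $x\in X$), and $q:W\otimes W\to W$ is the linear map with $q(x\otimes y)=x\triangleleft y$, $q(1\otimes x)=1$, $q(x\otimes 1)=0$, $q(1\otimes 1)=0$. For a linear map $\eta:W\otimes W\to W$, $d^{2,1}(\eta,0):W^{\otimes 3}\to W$ is $$d^{2,1}(\eta,0)=q(\eta\otimes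 1)+\eta(q\otimes 1)-\big[\eta(q\otimes q)+q(\eta\otimes q)+q(q\otimes\eta)\big](1\otimes\tau\otimes 1)(1\otimes 1\otimes\Delta),$$ where $\tau$ is the flip and $1$ in composites is the identity map. *)

theory Defs
  imports Complex_Main "HOL-Library.Poly_Mapping"
begin

text \<open>
  The vector space with basis \<open>B\<close> over a field \<open>'k\<close> is the set \<open>free_on B\<close> of finitely supported
  functions of type \<open>'b \<Rightarrow>\<^sub>0 'k\<close> whose support lies in \<open>B :: 'b set\<close>. The tensor product of the spaces
  with bases \<open>A\<close> and \<open>B\<close> is the space with basis \<open>A \<times> B\<close>, the pair \<open>(a, b)\<close> standing for
  \<open>a \<otimes> b\<close>; the lemmas \<open>bilinear_tensor\<close> and \<open>tensor_universal\<close> below state its universal property.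
\<close>

definition free_on :: "'b set \<Rightarrow> ('b \<Rightarrow>\<^sub>0 'k::zero) set" where
  "free_on B = {w. Poly_Mapping.keys w \<subseteq> B}"

abbreviation basis_vec :: "'b \<Rightarrow> ('b \<Rightarrow>\<^sub>0 'k::field)" where
  "basis_vec b \<equiv> Poly_Mapping.single b 1"

definition scale :: "'k::field \<Rightarrow> ('b \<Rightarrow>\<^sub>0 'k) \<Rightarrow> ('b \<Rightarrow>\<^sub>0 'k)" where
  "scale c w = Poly_Mapping.map ((*) c) w"

abbreviation lin :: "(('b \<Rightarrow>\<^sub>0 'k::field) \<Rightarrow> ('c \<Rightarrow>\<^sub>0 'k)) \<Rightarrow> bool" where
  "lin \<equiv> Vector_Spaces.linear scale scale"

definition lin_ext :: "('b \<Rightarrow> ('c \<Rightarrow>\<^sub>0 'k::field)) \<Rightarrow> ('b \<Rightarrow>\<^sub>0 'k) \<Rightarrow> ('c \<Rightarrow>\<^sub>0 'k)" where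
  "lin_ext g w = (\<Sum>b\<in>Poly_Mapping.keys w. scale (Poly_Mapping.lookup w b) (g b))"

lemma lookup_scale [simp]: "Poly_Mapping.lookup (scale c w) b = c * Poly_Mapping.lookup w b"
  by (simp add: scale_def map.rep_eq when_def)

lemma vector_space_scale: "vector_space (scale :: 'k::field \<Rightarrow> ('b \<Rightarrow>\<^sub>0 'k) \<Rightarrow> _)"
  by unfold_locales (auto intro!: poly_mapping_eqI simp: lookup_add algebra_simps)

interpretation free_vs: vector_space "scale :: 'k::field \<Rightarrow> ('b \<Rightarrow>\<^sub>0 'k) \<Rightarrow> _"
  by (rule vector_space_scale)

lemma linI:
  assumes "\<And>u v. f (u + v) = f u + f v" "\<And>c u. f (scale c u) = scale c (f u)"
  shows "lin f"
  by (simp add: Vector_Spaces.linear_iff assms vector_space_scale)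

lemma lin_add: "lin f \<Longrightarrow> f (u + v) = f u + f v"
  by (simp add: Vector_Spaces.linear_iff)

lemma lin_scale: "lin f \<Longrightarrow> f (scale c u) = scale c (f u)"
  by (simp add: Vector_Spaces.linear_iff)

lemma lin_ext_superset:
  assumes "finite S" "Poly_Mapping.keys w \<subseteq> S"
  shows "lin_ext g w = (\<Sum>b\<in>S. scale (Poly_Mapping.lookup w b) (g b))"
  unfolding lin_ext_def
  by (rule sum.mono_neutral_left) (use assms in \<open>auto simp: in_keys_iff\<close>)

lemma lin_lin_ext [simp]:
  fixes g :: "'b \<Rightarrow> ('c \<Rightarrow>\<^sub>0 'k::field)"
  shows "lin (lin_ext g)"
proof (rule linI)
  fix u v :: "'b \<Rightarrow>\<^sub>0 'k"
  let ?S = "Poly_Mapping.keys u \<union> Poly_Mapping.keys v"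
  have "lin_ext g (u + v) = (\<Sum>b\<in>?S. scale (Poly_Mapping.lookup (u + v) b) (g b))"
    using keys_add[of u v] by (intro lin_ext_superset) auto
  also have "\<dots> = (\<Sum>b\<in>?S. scale (Poly_Mapping.lookup u b) (g b))
      + (\<Sum>b\<in>?S. scale (Poly_Mapping.lookup v b) (g b))"
    by (simp add: lookup_add free_vs.scale_left_distrib sum.distrib)
  also have "\<dots> = lin_ext g u + lin_ext g v"
    by (simp add: lin_ext_superset[of ?S])
  finally show "lin_ext g (u + v) = lin_ext g u + lin_ext g v" .
next
  fix c and u :: "'b \<Rightarrow>\<^sub>0 'k"
  have "Poly_Mapping.keys (scale c u) \<subseteq> Poly_Mapping.keys u"
    by (auto simp: in_keys_iff)
  then have "lin_ext g (scale c u)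
      = (\<Sum>b\<in>Poly_Mapping.keys u. scale (Poly_Mapping.lookup (scale c u) b) (g b))"
    by (intro lin_ext_superset) auto
  also have "\<dots> = scale c (lin_ext g u)"
    by (simp add: lin_ext_def free_vs.scale_sum_right)
  finally show "lin_ext g (scale c u) = scale c (lin_ext g u)" .
qed

lemma lin_ext_basis [simp]: "lin_ext g (basis_vec b) = g b"
  by (simp add: lin_ext_def)

lemma lin_ext_unique:
  fixes f :: "('b \<Rightarrow>\<^sub>0 'k::field) \<Rightarrow> ('c \<Rightarrow>\<^sub>0 'k)"
  assumes "lin f"
  shows "f = lin_ext (\<lambda>b. f (basis_vec b))"
proof
  fix w :: "'b \<Rightarrow>\<^sub>0 'k"
  have "w = (\<Sum>b\<in>Poly_Mapping.keys w. scale (Poly_Mapping.lookup w b) (basis_vec b))"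
    by (rule poly_mapping_eqI)
      (simp add: lookup_sum lookup_single when_def in_keys_iff if_distrib[of "(*) _"] cong: if_cong)
  then have "f w = f (\<Sum>b\<in>Poly_Mapping.keys w. scale (Poly_Mapping.lookup w b) (basis_vec b))"
    by (rule arg_cong)
  also have "\<dots> = lin_ext (\<lambda>b. f (basis_vec b)) w"
  proof -
    interpret Vector_Spaces.linear scale scale f by fact
    show ?thesis by (simp add: lin_ext_def sum scale)
  qed
  finally show "f w = lin_ext (\<lambda>b. f (basis_vec b)) w" .
qed

lemma lin_eqI:
  assumes "lin f" "lin g" "\<And>b. f (basis_vec b) = g (basis_vec b)"
  shows "f w = g w"
proof -
  have "f w = lin_ext (\<lambda>b. f (basis_vec b)) w"
    by (rule fun_cong[OF lin_ext_unique[OF assms(1)]])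
  also have "\<dots> = lin_ext (\<lambda>b. g (basis_vec b)) w"
    by (simp only: assms(3))
  also have "\<dots> = g w"
    by (rule fun_cong[OF lin_ext_unique[OF assms(2)], symmetric])
  finally show ?thesis .
qed

definition tensor :: "('a \<Rightarrow>\<^sub>0 'k::field) \<Rightarrow> ('b \<Rightarrow>\<^sub>0 'k) \<Rightarrow> ('a \<times> 'b \<Rightarrow>\<^sub>0 'k)" where
  "tensor u v = lin_ext (\<lambda>a. lin_ext (\<lambda>b. basis_vec (a, b)) v) u"

definition tensor_map ::
  "(('a \<Rightarrow>\<^sub>0 'k::field) \<Rightarrow> ('c \<Rightarrow>\<^sub>0 'k)) \<Rightarrow> (('b \<Rightarrow>\<^sub>0 'k) \<Rightarrow> ('d \<Rightarrow>\<^sub>0 'k))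
    \<Rightarrow> ('a \<times> 'b \<Rightarrow>\<^sub>0 'k) \<Rightarrow> ('c \<times> 'd \<Rightarrow>\<^sub>0 'k)" where
  "tensor_map f g = lin_ext (\<lambda>(a, b). tensor (f (basis_vec a)) (g (basis_vec b)))"

definition flip :: "('a \<times> 'b \<Rightarrow>\<^sub>0 'k::field) \<Rightarrow> ('b \<times> 'a \<Rightarrow>\<^sub>0 'k)" where
  "flip = lin_ext (\<lambda>(a, b). basis_vec (b, a))"

definition assoc :: "(('a \<times> 'b) \<times> 'c \<Rightarrow>\<^sub>0 'k::field) \<Rightarrow> ('a \<times> 'b \<times> 'c \<Rightarrow>\<^sub>0 'k)" where
  "assoc = lin_ext (\<lambda>((a, b), c). basis_vec (a, b, c))"

definition unassoc :: "('a \<times> 'b \<times> 'c \<Rightarrow>\<^sub>0 'k::field) \<Rightarrow> (('a \<times> 'b) \<times> 'c \<Rightarrow>\<^sub>0 'k)" where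
  "unassoc = lin_ext (\<lambda>(a, b, c). basis_vec ((a, b), c))"

lemma tensor_basis [simp]: "tensor (basis_vec a) (basis_vec b) = basis_vec (a, b)"
  by (simp add: tensor_def)

lemma bilinear_tensor: "lin (\<lambda>u. tensor u v)" "lin (\<lambda>v. tensor u v)"
proof -
  show "lin (\<lambda>u. tensor u v)"
    unfolding tensor_def by simp
  show "lin (\<lambda>v. tensor u v)"
    by (rule linI)
      (simp_all add: tensor_def lin_ext_def[of _ u] lin_add lin_scale free_vs.scale_right_distrib
        sum.distrib free_vs.scale_sum_right mult.commute)
qed

lemma tensor_universal:
  fixes f :: "('a \<Rightarrow>\<^sub>0 'k::field) \<Rightarrow> ('b \<Rightarrow>\<^sub>0 'k) \<Rightarrow> ('c \<Rightarrow>\<^sub>0 'k)"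
  assumes "\<And>v. lin (\<lambda>u. f u v)" "\<And>u. lin (\<lambda>v. f u v)"
  shows "\<exists>!F. lin F \<and> (\<forall>u v. F (tensor u v) = f u v)"
proof (rule ex1I)
  define F where "F = lin_ext (\<lambda>(a, b). f (basis_vec a) (basis_vec b))"
  have linF: "lin F" by (simp add: F_def)
  have comp: "lin (\<lambda>u. F (g u))" if "lin g" for g :: "('e \<Rightarrow>\<^sub>0 'k) \<Rightarrow> _"
    by (rule linI) (simp_all add: lin_add[OF that] lin_scale[OF that] lin_add[OF linF] lin_scale[OF linF])
  have 1: "F (tensor (basis_vec a) v) = f (basis_vec a) v" for a v
    by (rule lin_eqI[OF comp[OF bilinear_tensor(2)] assms(2)]) (simp add: F_def)
  have "F (tensor u v) = f u v" for u v
    by (rule lin_eqI[OF comp[OF bilinear_tensor(1)] assms(1)]) (rule 1)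
  with linF show "lin F \<and> (\<forall>u v. F (tensor u v) = f u v)" by blast
  fix G :: "('a \<times> 'b \<Rightarrow>\<^sub>0 'k) \<Rightarrow> ('c \<Rightarrow>\<^sub>0 'k)"
  assume "lin G \<and> (\<forall>u v. G (tensor u v) = f u v)"
  then have G: "lin G" "\<And>u v. G (tensor u v) = f u v" by auto
  have GF: "G (basis_vec (a, b)) = f (basis_vec a) (basis_vec b)" for a b
    using G(2)[of "basis_vec a" "basis_vec b"] by simp
  show "G = F"
    by (rule ext, rule lin_eqI[OF G(1) linF]) (auto simp: F_def GF)
qed

lemma lin_tensor_map: "lin (tensor_map f g)"
  by (simp add: tensor_map_def)

lemma tensor_map_tensor:
  assumes "lin f" "lin g"
  shows "tensor_map f g (tensor u v) = tensor (f u) (g v)"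
proof -
  let ?h = "\<lambda>u v. tensor (f u) (g v)"
  have "lin (\<lambda>u. ?h u v)" "lin (\<lambda>v. ?h u v)" for u v
    by (rule linI; simp add: lin_add[OF assms(1)] lin_scale[OF assms(1)] lin_add[OF assms(2)]
        lin_scale[OF assms(2)] lin_add[OF bilinear_tensor(1)] lin_scale[OF bilinear_tensor(1)]
        lin_add[OF bilinear_tensor(2)] lin_scale[OF bilinear_tensor(2)])+
  then obtain F where F: "lin F" "\<And>u v. F (tensor u v) = ?h u v"
    using tensor_universal[of ?h] by blast
  have Fh: "F (basis_vec (a, b)) = ?h (basis_vec a) (basis_vec b)" for a b
    using F(2)[of "basis_vec a" "basis_vec b"] by simp
  have "F t = tensor_map f g t" for t
    by (rule lin_eqI[OF F(1) lin_tensor_map]) (auto simp: tensor_map_def Fh)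
  with F(2) show ?thesis by metis
qed

locale quandle =
  fixes X :: "'x set" and op :: "'x \<Rightarrow> 'x \<Rightarrow> 'x" (infixl \<open>\<triangleleft>\<close> 70)
  assumes closed: "\<lbrakk>a \<in> X; b \<in> X\<rbrakk> \<Longrightarrow> a \<triangleleft> b \<in> X"
    and idem: "a \<in> X \<Longrightarrow> a \<triangleleft> a = a"
    and right_div: "\<lbrakk>a \<in> X; b \<in> X\<rbrakk> \<Longrightarrow> \<exists>!c. c \<in> X \<and> a = c \<triangleleft> b"
    and self_distrib: "\<lbrakk>a \<in> X; b \<in> X; c \<in> X\<rbrakk> \<Longrightarrow> (a \<triangleleft> b) \<triangleleft> c = (a \<triangleleft> c) \<triangleleft> (b \<triangleleft> c)"

definition quandle_2_cocycle ::
  "'x set \<Rightarrow> ('x \<Rightarrow> 'x \<Rightarrow> 'x) \<Rightarrow> ('x \<Rightarrow> 'x \<Rightarrow> 'k::ab_group_add) \<Rightarrow> bool" where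
  "quandle_2_cocycle X op \<phi> \<longleftrightarrow>
     (\<forall>x\<in>X. \<forall>y\<in>X. \<forall>z\<in>X. \<phi> x y - \<phi> x z + \<phi> (op x y) z - \<phi> (op x z) (op y z) = 0) \<and>
     (\<forall>x\<in>X. \<phi> x x = 0)"

text \<open>
  \<open>W = k \<oplus> kX\<close> has the basis \<open>{1} \<union> X\<close>; its element \<open>1 \<in> k\<close> is the basis vector at \<open>None\<close> and
  \<open>x \<in> X\<close> is the basis vector at \<open>Some x\<close>. The maps below are defined on the ambient space
  \<open>'x option \<Rightarrow>\<^sub>0 'k\<close>, and only their restrictions to \<open>W\<close> and its tensor powers matter; the
  lemmas \<open>quandle_q_closed\<close> and \<open>phi_hat_closed\<close> say that \<open>W\<close> is preserved.
\<close>

definition W_basis :: "'x set \<Rightarrow> 'x option set" where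
  "W_basis X = insert None (Some ` X)"

definition W :: "'x set \<Rightarrow> ('x option \<Rightarrow>\<^sub>0 'k::field) set" where
  "W X = free_on (W_basis X)"

definition W2 :: "'x set \<Rightarrow> ('x option \<times> 'x option \<Rightarrow>\<^sub>0 'k::field) set" where
  "W2 X = free_on (W_basis X \<times> W_basis X)"

definition W3 :: "'x set \<Rightarrow> (('x option \<times> 'x option) \<times> 'x option \<Rightarrow>\<^sub>0 'k::field) set" where
  "W3 X = free_on ((W_basis X \<times> W_basis X) \<times> W_basis X)"

abbreviation W_one :: "'x option \<Rightarrow>\<^sub>0 'k::field" where
  "W_one \<equiv> basis_vec None"

abbreviation W_elt :: "'x \<Rightarrow> ('x option \<Rightarrow>\<^sub>0 'k::field)" where
  "W_elt x \<equiv> basis_vec (Some x)"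

definition comult :: "('x option \<Rightarrow>\<^sub>0 'k::field) \<Rightarrow> ('x option \<times> 'x option \<Rightarrow>\<^sub>0 'k)" where
  "comult = lin_ext (\<lambda>b. tensor (basis_vec b) (basis_vec b))"

(* The counit belongs to the coalgebra W but does not occur in the differential. *)
definition counit :: "('x option \<Rightarrow>\<^sub>0 'k::field) \<Rightarrow> 'k" where
  "counit w = (\<Sum>b\<in>Poly_Mapping.keys w. Poly_Mapping.lookup w b)"

fun quandle_q_basis :: "('x \<Rightarrow> 'x \<Rightarrow> 'x) \<Rightarrow> 'x option \<times> 'x option \<Rightarrow> ('x option \<Rightarrow>\<^sub>0 'k::field)" where
  "quandle_q_basis op (Some x, Some y) = W_elt (op x y)"
| "quandle_q_basis op (None, Some x) = W_one"
| "quandle_q_basis op (Some x, None) = 0"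
| "quandle_q_basis op (None, None) = 0"

definition quandle_q ::
  "('x \<Rightarrow> 'x \<Rightarrow> 'x) \<Rightarrow> ('x option \<times> 'x option \<Rightarrow>\<^sub>0 'k::field) \<Rightarrow> ('x option \<Rightarrow>\<^sub>0 'k)" where
  "quandle_q op = lin_ext (quandle_q_basis op)"

fun phi_hat_basis :: "('x \<Rightarrow> 'x \<Rightarrow> 'k::field) \<Rightarrow> 'x option \<times> 'x option \<Rightarrow> ('x option \<Rightarrow>\<^sub>0 'k)" where
  "phi_hat_basis \<phi> (Some x, Some y) = scale (\<phi> x y) W_one"
| "phi_hat_basis \<phi> (None, Some x) = W_one"
| "phi_hat_basis \<phi> (Some x, None) = 0"
| "phi_hat_basis \<phi> (None, None) = 0"

definition phi_hat ::
  "('x \<Rightarrow> 'x \<Rightarrow> 'k::field) \<Rightarrow> ('x option \<times> 'x option \<Rightarrow>\<^sub>0 'k) \<Rightarrow> ('x option \<Rightarrow>\<^sub>0 'k)" where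
  "phi_hat \<phi> = lin_ext (phi_hat_basis \<phi>)"

text \<open>
  \<open>middle_flip\<close> is \<open>1 \<otimes> \<tau> \<otimes> 1\<close>, with \<open>W\<^sup>\<otimes>\<^sup>4\<close> bracketed as \<open>(W \<otimes> W) \<otimes> (W \<otimes> W)\<close> at both ends;
  \<open>W\<^sup>\<otimes>\<^sup>3\<close> is bracketed as \<open>(W \<otimes> W) \<otimes> W\<close>.
\<close>

definition middle_flip ::
  "(('a \<times> 'b) \<times> ('c \<times> 'd) \<Rightarrow>\<^sub>0 'k::field) \<Rightarrow> (('a \<times> 'c) \<times> ('b \<times> 'd) \<Rightarrow>\<^sub>0 'k)" where
  "middle_flip = unassoc \<circ> tensor_map id (assoc \<circ> tensor_map flip id \<circ> unassoc) \<circ> assoc"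

text \<open>This is \<open>d\<^sup>2\<^sup>,\<^sup>1(\<eta>, 0)\<close>: only the value \<open>0\<close> of the second argument is covered.\<close>

definition d21_0 ::
  "(('x option \<times> 'x option \<Rightarrow>\<^sub>0 'k::field) \<Rightarrow> ('x option \<Rightarrow>\<^sub>0 'k))
    \<Rightarrow> (('x option \<times> 'x option \<Rightarrow>\<^sub>0 'k) \<Rightarrow> ('x option \<Rightarrow>\<^sub>0 'k))
    \<Rightarrow> (('x option \<times> 'x option) \<times> 'x option \<Rightarrow>\<^sub>0 'k) \<Rightarrow> ('x option \<Rightarrow>\<^sub>0 'k)" where
  "d21_0 q \<eta> t =
     q (tensor_map \<eta> id t) + \<eta> (tensor_map q id t)
     - (let s = middle_flip (tensor_map (tensor_map id id) comult t)
        in \<eta> (tensor_map q q s) + q (tensor_map \<eta> q s) + q (tensor_map q \<eta> s))"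

lemma middle_flip_basis: "middle_flip (basis_vec ((a, b), (c, d))) = basis_vec ((a, c), (b, d))"
  by (simp add: middle_flip_def assoc_def unassoc_def flip_def tensor_map_def)

lemma keys_lin_ext:
  assumes "w \<in> free_on A" "\<And>a. a \<in> A \<Longrightarrow> g a \<in> free_on B"
  shows "lin_ext g w \<in> free_on B"
proof -
  have "Poly_Mapping.lookup (lin_ext g w) b = 0" if "b \<notin> B" for b
    unfolding lin_ext_def lookup_sum using assms that
    by (intro sum.neutral) (auto simp: free_on_def in_keys_iff subset_iff)
  then show ?thesis by (auto simp: free_on_def in_keys_iff)
qed

lemma quandle_q_closed:
  assumes "quandle X op" "t \<in> W2 X"
  shows "quandle_q op t \<in> W X"
  unfolding quandle_q_def W_def
  by (rule keys_lin_ext[OF assms(2)[unfolded W2_def]])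
    (auto simp: W_basis_def free_on_def quandle.closed[OF assms(1)])

lemma phi_hat_closed:
  assumes "t \<in> W2 X"
  shows "phi_hat \<phi> t \<in> W X"
  unfolding phi_hat_def W_def
  by (rule keys_lin_ext[OF assms[unfolded W2_def]])
    (auto simp: W_basis_def free_on_def in_keys_iff lookup_single when_def split: if_splits)

end

theory Submission
  imports Defs
begin

text \<open>
  Every map in the differential is linear, so it suffices to evaluate it on the basis tensors
  \<open>a \<otimes> b \<otimes> c\<close> with \<open>a, b, c \<in> {1} \<union> X\<close>. All these elements are group-like, hence the
  comultiplication duplicates \<open>c\<close> and the differential becomes
  \<open>q(\<eta>(a,b),c) + \<eta>(q(a,b),c) - \<eta>(q(a,c),q(b,c)) - q(\<eta>(a,c),q(b,c)) - q(q(a,c),\<eta>(b,c))\<close>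
  (lemma \<open>d21_0_group_like\<close>).

  For \<open>\<eta> = phi_hat \<phi>\<close> the values lie in the line spanned by \<open>1\<close>, and \<open>q(1,z) = 1\<close>, \<open>q(w,1) = 0\<close>.
  So for \<open>x, y, z \<in> X\<close> the last term vanishes, and the other four are \<open>\<phi>(x,y)\<close>, \<open>\<phi>(x \<triangleleft> y, z)\<close>,
  \<open>\<phi>(x \<triangleleft> z, y \<triangleleft> z)\<close> and \<open>\<phi>(x,z)\<close>: their signed sum is the cocycle condition.
  If one of the entries is \<open>1\<close>, all terms vanish except for \<open>1 \<otimes> y \<otimes> z\<close>, where the first four
  terms are all \<open>1\<close> and cancel, and the last one is \<open>0\<close>.
\<close>

lemma lin_quandle_q: "lin (quandle_q op)"
  by (simp add: quandle_q_def)

lemma lin_phi_hat: "lin (phi_hat \<phi>)"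
  by (simp add: phi_hat_def)

lemma lin_zero: "lin f \<Longrightarrow> f 0 = 0"
  using lin_add[of f 0 0] by simp

lemma lin_comp:
  assumes "lin f" "lin g"
  shows "lin (f \<circ> g)"
  by (rule linI) (simp_all add: lin_add[OF assms(1)] lin_add[OF assms(2)]
      lin_scale[OF assms(1)] lin_scale[OF assms(2)])

lemma lin_middle_flip: "lin middle_flip"
  unfolding middle_flip_def assoc_def unassoc_def
  by (intro lin_comp lin_tensor_map lin_lin_ext)

lemma lin_d21_0:
  assumes q: "lin q" and \<eta>: "lin \<eta>"
  shows "lin (d21_0 q \<eta>)"
  by (rule linI)
    (simp_all add: d21_0_def Let_def lin_add[OF lin_tensor_map] lin_scale[OF lin_tensor_map]
      lin_add[OF lin_middle_flip] lin_scale[OF lin_middle_flip]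
      lin_add[OF q] lin_scale[OF q] lin_add[OF \<eta>] lin_scale[OF \<eta>]
      free_vs.scale_right_distrib free_vs.scale_right_diff_distrib)

lemma lin_vanishes_on_free:
  assumes "lin f" "t \<in> free_on B" "\<And>b. b \<in> B \<Longrightarrow> f (basis_vec b) = 0"
  shows "f t = 0"
proof -
  have "f t = lin_ext (\<lambda>b. f (basis_vec b)) t"
    by (rule fun_cong[OF lin_ext_unique[OF assms(1)]])
  also have "\<dots> = 0"
    unfolding lin_ext_def using assms(2,3)
    by (intro sum.neutral) (auto simp: free_on_def)
  finally show ?thesis .
qed

lemma tensor_map_basis:
  "tensor_map f g (basis_vec (a, b)) = tensor (f (basis_vec a)) (g (basis_vec b))"
  by (simp add: tensor_map_def)

text \<open>Since \<open>c\<close> is group-like, the middle flip receives \<open>(a \<otimes> b) \<otimes> (c \<otimes> c)\<close> and returns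
  \<open>(a \<otimes> c) \<otimes> (b \<otimes> c)\<close>. The five terms are the first-order part, in the direction \<open>\<eta>\<close>, of the
  self-distributive law \<open>q(q(a,b),c) = q(q(a,c),q(b,c))\<close>.\<close>

lemma d21_0_group_like:
  "d21_0 q \<eta> (basis_vec ((a, b), c)) =
     q (tensor (\<eta> (basis_vec (a, b))) (basis_vec c))
     + \<eta> (tensor (q (basis_vec (a, b))) (basis_vec c))
     - (\<eta> (tensor (q (basis_vec (a, c))) (q (basis_vec (b, c))))
        + q (tensor (\<eta> (basis_vec (a, c))) (q (basis_vec (b, c))))
        + q (tensor (q (basis_vec (a, c))) (\<eta> (basis_vec (b, c)))))"
  by (simp add: d21_0_def Let_def tensor_map_basis comult_def middle_flip_basis)

lemma tensor_zero [simp]: "tensor 0 v = 0" "tensor u 0 = 0"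
  by (rule lin_zero[OF bilinear_tensor(1)], rule lin_zero[OF bilinear_tensor(2)])

lemma tensor_scale [simp]:
  "tensor (scale c u) v = scale c (tensor u v)" "tensor u (scale c v) = scale c (tensor u v)"
  by (rule lin_scale[OF bilinear_tensor(1)], rule lin_scale[OF bilinear_tensor(2)])

lemma quandle_q_simps [simp]:
  "quandle_q op 0 = 0"
  "quandle_q op (scale c t) = scale c (quandle_q op t)"
  "quandle_q op (basis_vec ab) = quandle_q_basis op ab"
  by (rule lin_zero[OF lin_quandle_q], rule lin_scale[OF lin_quandle_q], simp add: quandle_q_def)

lemma phi_hat_simps [simp]:
  "phi_hat \<phi> 0 = 0"
  "phi_hat \<phi> (scale c t) = scale c (phi_hat \<phi> t)"
  "phi_hat \<phi> (basis_vec ab) = phi_hat_basis \<phi> ab"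
  by (rule lin_zero[OF lin_phi_hat], rule lin_scale[OF lin_phi_hat], simp add: phi_hat_def)

lemma d21_0_phi_hat_quandle_elements:
  "d21_0 (quandle_q op) (phi_hat \<phi>) (basis_vec ((Some x, Some y), Some z)) =
     scale (\<phi> x y - \<phi> x z + \<phi> (op x y) z - \<phi> (op x z) (op y z)) W_one"
  by (simp add: d21_0_group_like free_vs.scale_left_distrib free_vs.scale_left_diff_distrib)

lemma d21_0_phi_hat_unit_entry:
  assumes "a = None \<or> b = None \<or> c = None"
  shows "d21_0 (quandle_q op) (phi_hat \<phi>) (basis_vec ((a, b), c)) = 0"
  using assms by (cases a; cases b; cases c) (simp_all add: d21_0_group_like)

theorem theorem7p1:
  fixes X :: "'x set"
    and op :: "'x \<Rightarrow> 'x \<Rightarrow> 'x"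
    and \<phi> :: "'x \<Rightarrow> 'x \<Rightarrow> 'k::field"
  assumes "quandle X op"
    and "quandle_2_cocycle X op \<phi>"
  shows "\<forall>t \<in> W3 X. d21_0 (quandle_q op) (phi_hat \<phi>) t = 0"
proof
  fix t :: "('x option \<times> 'x option) \<times> 'x option \<Rightarrow>\<^sub>0 'k"
  assume "t \<in> W3 X"
  then have t: "t \<in> free_on ((W_basis X \<times> W_basis X) \<times> W_basis X)"
    by (simp add: W3_def)
  show "d21_0 (quandle_q op) (phi_hat \<phi>) t = 0"
  proof (rule lin_vanishes_on_free[OF lin_d21_0[OF lin_quandle_q lin_phi_hat] t])
    fix abc :: "('x option \<times> 'x option) \<times> 'x option"
    assume abc: "abc \<in> (W_basis X \<times> W_basis X) \<times> W_basis X"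
    obtain a b c where [simp]: "abc = ((a, b), c)"
      by (cases abc) auto
    show "d21_0 (quandle_q op) (phi_hat \<phi>) (basis_vec abc) = 0"
    proof (cases "a = None \<or> b = None \<or> c = None")
      case True
      then show ?thesis
        by (simp add: d21_0_phi_hat_unit_entry)
    next
      case False
      with abc obtain x y z where xyz: "x \<in> X" "y \<in> X" "z \<in> X"
        and [simp]: "a = Some x" "b = Some y" "c = Some z"
        by (auto simp: W_basis_def)
      have "\<phi> x y - \<phi> x z + \<phi> (op x y) z - \<phi> (op x z) (op y z) = 0"
        using assms(2) xyz by (simp add: quandle_2_cocycle_def)
      then show ?thesis
        by (simp add: d21_0_phi_hat_quandle_elements)
    qed
  qed
qed

end
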